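(* Let $M>1$ be a real number and let $\alpha:(0,M)\to[0,\infty)$ be a log-concave function. Then the function \[ f(x)=\int_{0}^{M}\alpha(s)\binom{M}{s}(1-x)^{s}x^{M-s}\,ds \] is log-concave in $x$ on the interval $(0,1)$.
   Context: A non-negative function $h$ on an open interval $I$ is called log-concave if for all $x,y\in I$ and all $0<\lambda<1$, $h(\lambda x+(1-\lambda)y)\ge h(x)^{\lambda}h(y)^{1-\lambda}$. For real $a$ and $s$, the generalized binomial coefficient is $\binom{a}{s}=\frac{\Gamma(a+1)}{\Gamma(s+1)\Gamma(a-s+1)}$, where $\Gamma$ is the Gamma function; equivalently, for $0\le s\le M$, $\binom{M}{s}=\frac{1}{(M+1)B(s+1,M-s+1)}$ with $B$ the Beta function. *)

theory Defs
  imports "HOL-Analysis.Analysis"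
begin

text \<open>A non-negative function h on an interval I is log-concave if
  h(l x + (1-l) y) >= h(x)^l h(y)^(1-l) for x, y in I and 0 < l < 1.
  Here powr is used; note 0 powr l = 0 for l > 0, matching real exponentiation.\<close>
definition log_concave_on :: "real set \<Rightarrow> (real \<Rightarrow> real) \<Rightarrow> bool" where
  "log_concave_on I h \<longleftrightarrow>
     (\<forall>x\<in>I. 0 \<le> h x) \<and>
     (\<forall>x\<in>I. \<forall>y\<in>I. \<forall>l::real. 0 < l \<and> l < 1 \<longrightarrow>
        h (l * x + (1 - l) * y) \<ge> h x powr l * h y powr (1 - l))"

definition gbinom :: "real \<Rightarrow> real \<Rightarrow> real" where
  "gbinom a s = Gamma (a + 1) / (Gamma (s + 1) * Gamma (a - s + 1))"

end

theory Submission
  imports Defs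
begin

text \<open>Substituting \<open>u = ln ((1 - x) / x)\<close> turns the transform into \<open>x\<^sup>M\<close> times the Laplace-type integral
  \<open>L(u)\<close> of \<open>\<alpha>(s) binom(M, s) exp(u s)\<close>. With \<open>m = L'/L\<close> and \<open>v = m'\<close>, the mean and the variance of
  the tilted density, the second derivative of \<open>ln f\<close> is nonpositive as soon as \<open>v \<le> m (1 - m / M)\<close>,
  because then it is at most \<open>- (M (1 - x) - m)\<^sup>2 / (M x\<^sup>2 (1 - x)\<^sup>2)\<close>.

  The variance bound says that the product density on \<open>(0, M)\<^sup>2\<close> has nonnegative integral against
  \<open>Q(a, b) = S (2 M - S) - (2 M - 1) (a - b)\<^sup>2\<close>, \<open>S = a + b\<close>, and this holds already on each line of
  constant \<open>S\<close>. By the symmetry \<open>a \<mapsto> M - a\<close> let \<open>S \<le> M\<close>. For \<open>S \<le> 1\<close> the kernel \<open>Q\<close> is nonnegative.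
  Otherwise it changes sign once in \<open>\<bar>a - b\<bar>\<close>, from plus to minus, while \<open>\<alpha>(a) \<alpha>(S - a)\<close> is decreasing
  in \<open>\<bar>a - b\<bar>\<close>, so that it suffices to treat constant \<open>\<alpha>\<close>. In that case the integrand is a difference
  \<open>H(a - 1) - H(a)\<close>, and its integral reduces to integrals of \<open>H\<close> over two unit intervals
  on which \<open>H\<close> has a sign.\<close>

section \<open>Log-concave functions on an interval\<close>

lemma log_concave_on_nonneg: "log_concave_on I h \<Longrightarrow> x \<in> I \<Longrightarrow> 0 \<le> h x"
  by (simp add: log_concave_on_def)

lemma log_concave_onD:
  assumes "log_concave_on I h" "x \<in> I" "y \<in> I" "0 < l" "l < 1"
  shows "h x powr l * h y powr (1 - l) \<le> h (l * x + (1 - l) * y)"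
  using assms by (simp add: log_concave_on_def)

text \<open>The factor \<open>exp (u * s)\<close> is log-affine and gives equality in the defining
  inequality. Closure under such tilts makes the variance bound available at every
  \<open>u\<close>.\<close>

lemma log_concave_on_exp_mult:
  assumes "log_concave_on I h"
  shows "log_concave_on I (\<lambda>s. h s * exp (u * s))"
  unfolding log_concave_on_def
proof (intro conjI ballI allI impI)
  fix x assume "x \<in> I"
  then show "0 \<le> h x * exp (u * x)"
    using log_concave_on_nonneg[OF assms] by simp
next
  fix x y l :: real
  assume *: "x \<in> I" "y \<in> I" "0 < l \<and> l < 1"
  have "(h x * exp (u * x)) powr l * (h y * exp (u * y)) powr (1 - l)
      = (h x powr l * h y powr (1 - l)) * (exp (u * x * l) * exp (u * y * (1 - l)))"
    using * log_concave_on_nonneg[OF assms] by (simp add: powr_mult exp_powr_real)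
  also have "exp (u * x * l) * exp (u * y * (1 - l)) = exp (u * (l * x + (1 - l) * y))"
    by (simp add: algebra_simps flip: exp_add)
  also have "(h x powr l * h y powr (1 - l)) * \<dots>
      \<le> h (l * x + (1 - l) * y) * exp (u * (l * x + (1 - l) * y))"
    by (intro mult_right_mono log_concave_onD[OF assms]) (use * in auto)
  finally show "h (l * x + (1 - l) * y) * exp (u * (l * x + (1 - l) * y))
      \<ge> (h x * exp (u * x)) powr l * (h y * exp (u * y)) powr (1 - l)" .
qed

lemma log_concave_on_reflect:
  assumes "log_concave_on {0<..<M} h"
  shows "log_concave_on {0<..<M} (\<lambda>s. h (M - s))"
  unfolding log_concave_on_def
proof (intro conjI ballI allI impI)
  fix x assume "x \<in> {0<..<M}"
  then show "0 \<le> h (M - x)"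
    using log_concave_on_nonneg[OF assms] by simp
next
  fix x y l :: real
  assume *: "x \<in> {0<..<M}" "y \<in> {0<..<M}" "0 < l \<and> l < 1"
  have "h (M - x) powr l * h (M - y) powr (1 - l) \<le> h (l * (M - x) + (1 - l) * (M - y))"
    by (intro log_concave_onD[OF assms]) (use * in auto)
  also have "l * (M - x) + (1 - l) * (M - y) = M - (l * x + (1 - l) * y)"
    by (simp add: algebra_simps)
  finally show "h (M - x) powr l * h (M - y) powr (1 - l) \<le> h (M - (l * x + (1 - l) * y))" .
qed

text \<open>The closer pair consists of convex combinations of \<open>a\<close> and \<open>b\<close>
  with swapped weights, so multiplying the two log-concavity inequalities recombines the powers into
  \<open>h a * h b\<close>.\<close>

lemma log_concave_on_mult_le:
  assumes h: "log_concave_on I h" and I: "a \<in> I" "b \<in> I"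
    and S: "a + b = a' + b'" and d: "\<bar>a' - b'\<bar> \<le> \<bar>a - b\<bar>"
  shows "h a * h b \<le> h a' * h b'"
proof (cases "{a', b'} = {a, b}")
  case True
  then show ?thesis by (auto simp: doubleton_eq_iff)
next
  case False
  \<comment> \<open>With coincident pairs excluded, the weight \<open>l\<close> below lies strictly
    between 0 and 1.\<close>
  have "a' \<noteq> b \<and> a' \<noteq> a"
    using False S by (auto simp: insert_commute)
  then have ne: "a \<noteq> b" and strict: "\<bar>a' - b'\<bar> < \<bar>a - b\<bar>"
    using S d by auto
  define l where "l = (a' - b) / (a - b)"
  have l: "0 < l" "l < 1"
    using ne strict S unfolding l_def by (auto simp: field_simps abs_if split: if_splits)
  have "l * (a - b) = a' - b"
    using ne by (simp add: l_def)
  then have a': "a' = l * a + (1 - l) * b"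
    by (simp add: algebra_simps)
  have b': "b' = l * b + (1 - l) * a"
  proof -
    have "b' = a + b - a'"
      using S by simp
    then show ?thesis
      unfolding a' by (simp add: algebra_simps)
  qed
  have nn: "0 \<le> h a" "0 \<le> h b"
    using h I by (auto intro: log_concave_on_nonneg)
  have "h a * h b = (h a powr l * h a powr (1 - l)) * (h b powr l * h b powr (1 - l))"
    using nn by (simp flip: powr_add)
  also have "\<dots> = (h a powr l * h b powr (1 - l)) * (h b powr l * h a powr (1 - l))"
    by simp
  also have "\<dots> \<le> h a' * h b'"
    unfolding a' b' using log_concave_onD[OF h I l] log_concave_onD[OF h I(2,1) l] order_trans
    by (intro mult_mono) (auto intro: order_trans[rotated])
  finally show ?thesis .
qed

text \<open>Quasi-concavity: bounding both values below by their minimum \<open>m\<close> collapses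
  the weighted powers to \<open>m\<close>.\<close>

lemma log_concave_on_min_le:
  assumes h: "log_concave_on I h" and I: "x \<in> I" "y \<in> I" and z: "x \<le> z" "z \<le> y"
  shows "min (h x) (h y) \<le> h z"
proof (cases "z = x \<or> z = y")
  case False
  then have xy: "x < z" "z < y"
    using z by auto
  define l where "l = (y - z) / (y - x)"
  define m where "m = min (h x) (h y)"
  have l: "0 < l" "l < 1"
    using xy by (auto simp: l_def)
  have "l * (y - x) = y - z"
    using xy by (simp add: l_def)
  then have z: "z = l * x + (1 - l) * y"
    by (simp add: algebra_simps)
  have m: "0 \<le> m"
    using h I by (auto simp: m_def intro: log_concave_on_nonneg)
  then have "m = m powr l * m powr (1 - l)"
    by (simp flip: powr_add)
  also have "\<dots> \<le> h x powr l * h y powr (1 - l)"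
    using m l by (intro mult_mono powr_mono2) (auto simp: m_def)
  also have "\<dots> \<le> h z"
    using log_concave_onD[OF h I l] z by simp
  finally show ?thesis
    by (simp add: m_def)
qed auto

text \<open>By quasi-concavity the superlevel sets of the zero extension are intervals for
  \<open>t \<ge> 0\<close>; for \<open>t < 0\<close> they are the whole line.\<close>

lemma log_concave_on_borel_measurable:
  assumes h: "log_concave_on I h" and I: "is_interval (I :: real set)"
  shows "(\<lambda>s. indicator I s * h s) \<in> borel_measurable borel"
  unfolding borel_measurable_iff_greater
proof
  fix t
  show "{w \<in> space borel. t < indicator I w * h w} \<in> sets borel"
  proof (cases "t < 0")
    case True
    then have "{w \<in> space borel. t < indicator I w * h w} = UNIV"
      using log_concave_on_nonneg[OF h] by (force simp: indicator_def)
    then show ?thesis by simp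
  next
    case False
    then have *: "{w \<in> space borel. t < indicator I w * h w} = {w \<in> I. t < h w}"
      by (auto simp: indicator_def)
    have "is_interval {w \<in> I. t < h w}"
      unfolding is_interval_1
    proof (intro ballI allI impI)
      fix x y z
      assume x: "x \<in> {w \<in> I. t < h w}" and y: "y \<in> {w \<in> I. t < h w}" and z: "x \<le> z \<and> z \<le> y"
      have "z \<in> I"
        using I x y z unfolding is_interval_1 by blast
      moreover have "t < h z"
        using log_concave_on_min_le[OF h, of x y z] x y z by auto
      ultimately show "z \<in> {w \<in> I. t < h w}"
        by simp
    qed
    then show ?thesis
      unfolding * by (rule real_interval_borel_measurable)
  qed
qed

text \<open>With positive values at \<open>p < q\<close> and \<open>m\<close> their midpoint, log-concavity on the segment from \<open>x\<close>
  through \<open>m\<close> to the far one of \<open>p\<close>, \<open>q\<close> bounds \<open>h x\<close> by a power of \<open>h m\<close> with bounded exponent.\<close>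

lemma log_concave_on_bounded:
  assumes h: "log_concave_on {0<..<M} h"
  obtains B where "\<And>x. x \<in> {0<..<M} \<Longrightarrow> h x \<le> B"
proof (cases "\<exists>p q. p \<in> {0<..<M} \<and> q \<in> {0<..<M} \<and> p < q \<and> 0 < h p \<and> 0 < h q")
  case True
  then obtain p q where pq: "p \<in> {0<..<M}" "q \<in> {0<..<M}" "p < q" "0 < h p" "0 < h q"
    by blast
  define m where "m = (p + q) / 2"
  \<comment> \<open>The cap at 1 gives \<open>k \<le> k powr (1 - l)\<close>, a lower bound free of
    \<open>l\<close>. The weight of \<open>x\<close> is \<open>(q - p) / 2\<close> over a length
    below \<open>M\<close>, hence at least \<open>l0\<close>.\<close>
  define k where "k = min 1 (min (h p) (h q))"
  define l0 where "l0 = (q - p) / (2 * M)"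
  define B where "B = h m / k"
  have M: "0 < M" and k: "0 < k" "k \<le> 1" and l0: "0 < l0"
    using pq by (auto simp: k_def l0_def)
  have key: "h x \<le> max 1 (B powr (1 / l0))"
    if x: "x \<in> {0<..<M}" and r: "r \<in> {0<..<M}" "k \<le> h r" and l: "l0 \<le> l" "l < 1"
      and m: "m = l * x + (1 - l) * r" for x r l
  proof (cases "h x \<le> 1")
    case False
    have "k \<le> k powr (1 - l)"
      using k l l0 powr_mono'[of "1 - l" 1 k] by simp
    also have "\<dots> \<le> h r powr (1 - l)"
      using k r l by (intro powr_mono2) auto
    finally have kr: "k \<le> h r powr (1 - l)" .
    have "h x powr l0 * k \<le> h x powr l * h r powr (1 - l)"
      using False l k kr by (intro mult_mono powr_mono) auto
    also have "\<dots> \<le> h m"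
      unfolding m using x r l l0 by (intro log_concave_onD[OF h]) auto
    finally have "h x powr l0 \<le> B"
      using k by (simp add: B_def field_simps)
    then have "(h x powr l0) powr (1 / l0) \<le> B powr (1 / l0)"
      using l0 by (intro powr_mono2) auto
    then show ?thesis
      using False l0 by (simp add: powr_powr)
  qed auto
  have "h x \<le> max (h m) (max 1 (B powr (1 / l0)))" if x: "x \<in> {0<..<M}" for x
  proof -
    consider "x = m" | "x < m" | "m < x"
      by linarith
    then show ?thesis
    proof cases
      case 2
      define l where "l = (q - m) / (q - x)"
      have "x < q"
        using 2 pq by (simp add: m_def)
      have eq: "q - m = (q - p) / 2"
        by (simp add: m_def field_simps)
      have "l0 \<le> l"
        unfolding l0_def l_def eq divide_divide_eq_left using \<open>x < q\<close> x pq
        by (intro divide_left_mono) auto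
      moreover have "l < 1"
        unfolding l_def using 2 \<open>x < q\<close> by simp
      moreover have "l * (q - x) = q - m"
        using \<open>x < q\<close> by (simp add: l_def)
      then have "m = l * x + (1 - l) * q"
        by (simp add: algebra_simps)
      ultimately have "h x \<le> max 1 (B powr (1 / l0))"
        using pq by (intro key[OF x, of q l]) (auto simp: k_def)
      then show ?thesis by simp
    next
      case 3
      define l where "l = (m - p) / (x - p)"
      have "p < x"
        using 3 pq by (simp add: m_def)
      have eq: "m - p = (q - p) / 2"
        by (simp add: m_def field_simps)
      have "l0 \<le> l"
        unfolding l0_def l_def eq divide_divide_eq_left using \<open>p < x\<close> x pq
        by (intro divide_left_mono) auto
      moreover have "l < 1"
        unfolding l_def using 3 \<open>p < x\<close> by simp
      moreover have "l * (x - p) = m - p"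
        using \<open>p < x\<close> by (simp add: l_def)
      then have "m = l * x + (1 - l) * p"
        by (simp add: algebra_simps)
      ultimately have "h x \<le> max 1 (B powr (1 / l0))"
        using pq by (intro key[OF x, of p l]) (auto simp: k_def)
      then show ?thesis by simp
    qed simp
  qed
  then show ?thesis
    by (rule that)
next
  case False
  \<comment> \<open>At most one point has a positive value; that value, or 0, is the bound.\<close>
  show ?thesis
  proof (cases "\<exists>p\<in>{0<..<M}. 0 < h p")
    case True
    then obtain p where p: "p \<in> {0<..<M}" "0 < h p" by blast
    have "h x \<le> h p" if "x \<in> {0<..<M}" for x
    proof (cases x p rule: linorder_cases)
      case less
      then show ?thesis using False p that by fastforce
    next
      case greater
      then show ?thesis using False p that by fastforce
    qed simp
    then show ?thesis by (rule that)
  next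
    case False
    then show ?thesis by (intro that[of 0]) force
  qed
qed

section \<open>The kernel on a line of constant sum\<close>

text \<open>At 0 the pole of \<open>Gamma\<close> is a zero of \<open>rGamma\<close>, so closed
  intervals ending there are covered.\<close>

lemma rGamma_real_nonneg: "0 \<le> x \<Longrightarrow> 0 \<le> rGamma (x :: real)"
  by (cases "x = 0") (simp_all add: rGamma_inverse_Gamma Gamma_real_pos less_imp_le)

text \<open>The reciprocal Gamma function is entire, so the telescoping identity below holds for all real
  arguments, including those where \<^const>\<open>Gamma\<close> has poles.\<close>

definition binom_weight :: "real \<Rightarrow> real \<Rightarrow> real" where
  "binom_weight M s = rGamma (s + 1) * rGamma (M - s + 1)"

lemma gbinom_eq_binom_weight: "gbinom M s = Gamma (M + 1) * binom_weight M s"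
  by (simp add: gbinom_def binom_weight_def rGamma_inverse_Gamma divide_simps)

lemma binom_weight_nonneg: "0 \<le> s \<Longrightarrow> s \<le> M \<Longrightarrow> 0 \<le> binom_weight M s"
  by (simp add: binom_weight_def rGamma_real_nonneg)

lemma binom_weight_reflect: "binom_weight M (M - s) = binom_weight M s"
  by (simp add: binom_weight_def mult.commute)

lemma continuous_on_rGamma_compose:
  "continuous_on A g \<Longrightarrow> continuous_on A (\<lambda>x. rGamma (g x :: real))"
  by (rule continuous_on_compose2[OF continuous_on_rGamma[of UNIV]]) auto

lemma continuous_on_binom_weight:
  "continuous_on A g \<Longrightarrow> continuous_on A (\<lambda>x. binom_weight M (g x))"
  unfolding binom_weight_def by (intro continuous_intros continuous_on_rGamma_compose)

text \<open>Integrated against \<open>W a * W b\<close>, this gives four times the gap in the moment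
  form of \<open>v \<le> m (1 - m / M)\<close>, where the right side is the binomial variance for
  \<open>M\<close> trials and mean \<open>m\<close>.\<close>

definition var_kernel :: "real \<Rightarrow> real \<Rightarrow> real \<Rightarrow> real" where
  "var_kernel M a b = (a + b) * (2 * M - (a + b)) - (2 * M - 1) * (a - b)\<^sup>2"

text \<open>A discrete antiderivative in \<open>a\<close> for step 1. It is odd about
  \<open>a = (S - 1) / 2\<close>: the reflection swaps the \<open>rGamma\<close> factors in pairs
  and negates the linear factor.\<close>

definition kernel_potential :: "real \<Rightarrow> real \<Rightarrow> real \<Rightarrow> real" where
  "kernel_potential M S a =
     (S - 1 - 2 * a) * (rGamma (a + 1) * rGamma (M - a) * (rGamma (S - a) * rGamma (M - S + a + 1)))"

text \<open>The functional equation \<open>rGamma z = z * rGamma (z + 1)\<close> turns every term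
  into a polynomial times the common product \<open>P * Q * R * T\<close>; what remains is a
  polynomial identity.\<close>

lemma var_kernel_telescopes:
  "binom_weight M a * binom_weight M (S - a) * var_kernel M a (S - a)
     = 2 * (kernel_potential M S (a - 1) - kernel_potential M S a)"
proof -
  define P Q R T where "P = rGamma (a + 1)" "Q = rGamma (M - a + 1)"
    "R = rGamma (S - a + 1)" "T = rGamma (M - S + a + 1)"
  have shifts: "rGamma a = a * P" "rGamma (M - a) = (M - a) * Q"
    "rGamma (S - a) = (S - a) * R" "rGamma (M - S + a) = (M - S + a) * T"
    using rGamma_plus1[of a] rGamma_plus1[of "M - a"] rGamma_plus1[of "S - a"]
      rGamma_plus1[of "M - S + a"] by (simp_all add: P_Q_R_T_def)
  have args: "M - (a - 1) = M - a + 1" "S - (a - 1) = S - a + 1" "M - (S - a) + 1 = M - S + a + 1"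
    "M - S + (a - 1) + 1 = M - S + a" "a - 1 + 1 = a"
    by simp_all
  show ?thesis
    unfolding binom_weight_def kernel_potential_def var_kernel_def args shifts
    unfolding P_Q_R_T_def[symmetric] by (simp add: algebra_simps power2_eq_square)
qed

text \<open>This is the case of constant \<alpha>. After the shift by 1 the two integrals of
  \<open>H\<close> share \<open>{0..S - 1}\<close>, and only the end intervals
  \<open>{-1..0}\<close> and \<open>{S - 1..S}\<close> survive.\<close>

lemma integral_var_kernel_nonneg:
  assumes S: "1 < S" "S \<le> M"
  shows "0 \<le> integral {0..S} (\<lambda>a. binom_weight M a * binom_weight M (S - a) * var_kernel M a (S - a))"
proof -
  define H where "H = kernel_potential M S"
  have cont: "continuous_on A H" for A
    unfolding H_def kernel_potential_def by (intro continuous_intros continuous_on_rGamma_compose)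
  have int: "H integrable_on {x..y}" for x y
    using cont by (intro integrable_continuous_interval)
  have "continuous_on A (\<lambda>a. H (a - 1))" for A
    by (rule continuous_on_compose2[OF cont[of UNIV]]) (auto intro!: continuous_intros)
  then have int': "(\<lambda>a. H (a - 1)) integrable_on {x..y}" for x y
    by (intro integrable_continuous_interval)
  have "integral {0..S} (\<lambda>a. binom_weight M a * binom_weight M (S - a) * var_kernel M a (S - a))
      = 2 * (integral {0..S} (\<lambda>a. H (a - 1)) - integral {0..S} H)"
    unfolding var_kernel_telescopes H_def[symmetric]
    using int int' by (simp add: integral_diff)
  also have "integral {0..S} (\<lambda>a. H (a - 1)) = integral {-1..S - 1} H"
    using integral_shift_Icc_real[of 0 S H "-1"] by (simp add: o_def)
  also have "\<dots> = integral {-1..0} H + integral {0..S - 1} H"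
    using S int by (intro Henstock_Kurzweil_Integration.integral_combine[symmetric]) auto
  also have "integral {0..S} H = integral {0..S - 1} H + integral {S - 1..S} H"
    using S int by (intro Henstock_Kurzweil_Integration.integral_combine[symmetric]) auto
  also have "2 * (integral {-1..0} H + integral {0..S - 1} H - (integral {0..S - 1} H + integral {S - 1..S} H))
     = 2 * (integral {-1..0} H - integral {S - 1..S} H)"
    by simp
  \<comment> \<open>Here \<open>S - 1 - 2 * a\<close> is positive, and \<open>S \<le> M\<close>
    keeps the last argument \<open>M - S + a + 1\<close> nonnegative down to
    \<open>a = -1\<close>.\<close>
  moreover have "0 \<le> integral {-1..0} H"
    using int S by (intro integral_nonneg)
      (auto simp: H_def kernel_potential_def intro!: mult_nonneg_nonneg rGamma_real_nonneg)
  \<comment> \<open>On this interval the linear factor is at most \<open>1 - S < 0\<close>, while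
    all \<open>rGamma\<close> arguments stay nonnegative.\<close>
  moreover have "integral {S - 1..S} H \<le> 0"
  proof -
    have "0 \<le> integral {S - 1..S} (\<lambda>a. - H a)"
    proof (rule integral_nonneg)
      fix a assume "a \<in> {S - 1..S}"
      then show "0 \<le> - H a"
        using S unfolding H_def kernel_potential_def mult_minus_left[symmetric]
        by (intro mult_nonneg_nonneg rGamma_real_nonneg) auto
    qed (use int in \<open>simp add: integrable_neg\<close>)
    then show ?thesis by simp
  qed
  ultimately show ?thesis by simp
qed

text \<open>The zero extension lets integrals along \<open>a + b = S\<close> run over the whole
  line. The constant \<open>Gamma (M + 1)\<close> is left out because the variance bound is
  homogeneous.\<close>

definition truncated_density :: "real \<Rightarrow> (real \<Rightarrow> real) \<Rightarrow> real \<Rightarrow> real" where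
  "truncated_density M h s = indicator {0<..<M} s * (h s * binom_weight M s)"

lemma truncated_density_nonneg:
  assumes "log_concave_on {0<..<M} h"
  shows "0 \<le> truncated_density M h s"
  using log_concave_on_nonneg[OF assms] binom_weight_nonneg[of s M]
  by (auto simp: truncated_density_def indicator_def)

text \<open>For \<open>S \<le> M\<close> the line meets the open square in \<open>0 < a < S\<close>,
  where the product of the two values of \<open>h\<close> is compared with its value at the sign
  change of the kernel.\<close>

lemma line_integral_nonneg_aux:
  assumes M: "1 < M" and h: "log_concave_on {0<..<M} h" and S: "S \<le> M"
  shows "0 \<le> (\<integral>a. truncated_density M h a * truncated_density M h (S - a) * var_kernel M a (S - a) \<partial>lborel)"
    (is "0 \<le> integral\<^sup>L lborel ?F")
proof (cases "S \<le> 1")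
  case True
  \<comment> \<open>On the segment \<open>\<bar>a - b\<bar> \<le> S\<close>, so the kernel is at
    least \<open>2 * M * S * (1 - S)\<close>.\<close>
  have "0 \<le> ?F a" for a
  proof (cases "0 < a \<and> a < S")
    case a: True
    have "\<bar>a - (S - a)\<bar> \<le> \<bar>S\<bar>"
      using a by auto
    then have "(a - (S - a))\<^sup>2 \<le> S\<^sup>2"
      by (simp only: abs_le_square_iff)
    then have "(2 * M - 1) * (a - (S - a))\<^sup>2 \<le> (2 * M - 1) * S\<^sup>2"
      using M by (intro mult_left_mono) auto
    moreover have "0 \<le> 2 * M * (S * (1 - S))"
      using a True M by auto
    ultimately have "0 \<le> var_kernel M a (S - a)"
      by (simp add: var_kernel_def algebra_simps power2_eq_square)
    then show ?thesis
      using truncated_density_nonneg[OF h] by (intro mult_nonneg_nonneg)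
  qed (auto simp: truncated_density_def)
  then show ?thesis
    by (rule Bochner_Integration.integral_nonneg)
next
  case False
  then have S1: "1 < S" by simp
  \<comment> \<open>\<open>D\<close> is the value of \<open>\<bar>a - b\<bar>\<close> at which the
    kernel vanishes; \<open>S > 1\<close> puts it inside the segment.\<close>
  define D where "D = sqrt (S * (2 * M - S) / (2 * M - 1))"
  have D0: "0 \<le> D" and D2: "(2 * M - 1) * D\<^sup>2 = S * (2 * M - S)"
    using M S S1 by (auto simp: D_def)
  have DS: "D < S"
  proof (rule power2_less_imp_less)
    have "0 < 2 * M * (S * (S - 1))"
      using S1 M by auto
    then have "(2 * M - 1) * D\<^sup>2 < (2 * M - 1) * S\<^sup>2"
      unfolding D2 by (simp add: algebra_simps power2_eq_square)
    then show "D\<^sup>2 < S\<^sup>2"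
      using M by simp
  qed (use S1 in simp)
  \<comment> \<open>\<open>G\<close> is the product of the values of \<open>h\<close> at the two
    points of the line with \<open>\<bar>a - b\<bar> = D\<close>.\<close>
  define G where "G = h ((S - D) / 2) * h ((S + D) / 2)"
  define K where "K a = binom_weight M a * binom_weight M (S - a) * var_kernel M a (S - a)" for a
  have Dmem: "(S - D) / 2 \<in> {0<..<M}" "(S + D) / 2 \<in> {0<..<M}"
    using D0 DS S by auto
  have le: "G * (indicator {0<..<S} a * K a) \<le> ?F a" for a
  proof (cases "a \<in> {0<..<S}")
    case True
    then have mem: "a \<in> {0<..<M}" "S - a \<in> {0<..<M}"
      using S by auto
    have vk: "var_kernel M a (S - a) = (2 * M - 1) * (D\<^sup>2 - (a - (S - a))\<^sup>2)"
      using right_diff_distrib[of "2 * M - 1" "D\<^sup>2" "(a - (S - a))\<^sup>2"] D2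
      unfolding var_kernel_def by simp
    \<comment> \<open>Both factors pass from nonnegative to nonpositive as
      \<open>\<bar>a - b\<bar>\<close> crosses \<open>D\<close>.\<close>
    have "0 \<le> (h a * h (S - a) - G) * var_kernel M a (S - a)"
    proof (cases "\<bar>a - (S - a)\<bar> \<le> D")
      case True
      then have "G \<le> h a * h (S - a)"
        unfolding G_def using Dmem D0 by (intro log_concave_on_mult_le[OF h]) (auto simp: field_simps)
      moreover have "(a - (S - a))\<^sup>2 \<le> D\<^sup>2"
        using True D0 by (simp add: abs_le_square_iff[symmetric])
      ultimately show ?thesis
        unfolding vk using M by simp
    next
      case False
      then have "h a * h (S - a) \<le> G"
        unfolding G_def using mem D0 by (intro log_concave_on_mult_le[OF h]) (auto simp: field_simps)
      moreover have "D\<^sup>2 \<le> (a - (S - a))\<^sup>2"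
        using False D0 by (simp add: abs_le_square_iff[symmetric])
      ultimately show ?thesis
        unfolding vk using M by (intro mult_nonpos_nonpos mult_nonneg_nonpos) auto
    qed
    moreover have "0 \<le> binom_weight M a * binom_weight M (S - a)"
      using mem by (intro mult_nonneg_nonneg binom_weight_nonneg) auto
    ultimately have "0 \<le> (binom_weight M a * binom_weight M (S - a)) *
        ((h a * h (S - a) - G) * var_kernel M a (S - a))"
      by (rule mult_nonneg_nonneg[rotated])
    then show ?thesis
      using True mem by (simp add: truncated_density_def K_def algebra_simps)
  qed (auto simp: truncated_density_def)
  have "continuous_on {0..S} K"
    unfolding K_def var_kernel_def by (intro continuous_intros continuous_on_binom_weight)
  then have "set_integrable lborel {0..S} K"
    by (rule borel_integrable_atLeastAtMost')
  then have K_int: "set_integrable lborel {0<..<S} K"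
    by (rule set_integrable_subset) auto
  have "(LINT a:{0<..<S}|lborel. K a) = integral {0..S} K"
    using set_borel_integral_eq_integral(2)[OF K_int] by (simp add: integral_open_interval_real)
  then have K_nonneg: "0 \<le> (LINT a:{0<..<S}|lborel. K a)"
    using integral_var_kernel_nonneg[OF S1 S] by (simp add: K_def[abs_def])
  have G: "0 \<le> G"
    unfolding G_def using Dmem by (intro mult_nonneg_nonneg log_concave_on_nonneg[OF h]) auto
  show ?thesis
  \<comment> \<open>A non-integrable function has Bochner integral 0 by convention, which settles
    the other case.\<close>
  proof (cases "integrable lborel ?F")
    case True
    have "0 \<le> G * (LINT a:{0<..<S}|lborel. K a)"
      using G K_nonneg by simp
    also have "\<dots> = (\<integral>a. G * (indicator {0<..<S} a * K a) \<partial>lborel)"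
      by (simp add: set_lebesgue_integral_def)
    also have "\<dots> \<le> integral\<^sup>L lborel ?F"
      using K_int True le by (intro integral_mono) (auto simp: set_integrable_def)
    finally show ?thesis .
  qed (simp add: not_integrable_integral_eq)
qed

text \<open>The reflection \<open>a \<mapsto> M - a\<close> in both coordinates maps the line of sum
  \<open>S\<close> to that of sum \<open>2 * M - S\<close> and preserves the kernel.\<close>

lemma line_integral_nonneg:
  assumes M: "1 < M" and h: "log_concave_on {0<..<M} h"
  shows "0 \<le> (\<integral>a. truncated_density M h a * truncated_density M h (S - a) * var_kernel M a (S - a) \<partial>lborel)"
proof (cases "S \<le> M")
  case True
  then show ?thesis
    by (rule line_integral_nonneg_aux[OF M h])
next
  case False
  define h' where "h' s = h (M - s)" for s
  have refl: "truncated_density M h (M - a) = truncated_density M h' a" for a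
    by (auto simp: truncated_density_def binom_weight_reflect h'_def indicator_def)
  have refl': "truncated_density M h (S - (M - a)) = truncated_density M h' ((2 * M - S) - a)" for a
    using refl[of "(2 * M - S) - a"] by (simp add: algebra_simps)
  have vk: "var_kernel M (M - a) (S - (M - a)) = var_kernel M a ((2 * M - S) - a)" for a
    by (simp add: var_kernel_def algebra_simps power2_eq_square)
  have "(\<integral>a. truncated_density M h a * truncated_density M h (S - a) * var_kernel M a (S - a) \<partial>lborel)
     = (\<integral>a. truncated_density M h (M - a) * truncated_density M h (S - (M - a))
            * var_kernel M (M - a) (S - (M - a)) \<partial>lborel)"
    by (subst lborel_integral_real_affine[where c = "-1" and t = M]) auto
  also have "\<dots> = (\<integral>a. truncated_density M h' a * truncated_density M h' ((2 * M - S) - a)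
            * var_kernel M a ((2 * M - S) - a) \<partial>lborel)"
    unfolding refl refl' vk ..
  also have "\<dots> \<ge> 0"
    using False log_concave_on_reflect[OF h] unfolding h'_def[symmetric]
    by (intro line_integral_nonneg_aux[OF M]) auto
  finally show ?thesis .
qed

section \<open>The variance bound\<close>

text \<open>Integrating the line integrals over \<open>S\<close> gives, by Fubini and the
  substitution \<open>S = a + b\<close>, the double integral of the kernel against
  \<open>W a * W b\<close>, which expands into moments.\<close>

lemma variance_bound_of_line_integrals:
  fixes W :: "real \<Rightarrow> real"
  assumes M: "0 < M" and W[measurable]: "W \<in> borel_measurable borel"
    and bnd: "\<And>s. \<bar>W s\<bar> \<le> B" and supp: "\<And>s. s \<notin> {0..M} \<Longrightarrow> W s = 0"
    and int: "integrable lborel W" "integrable lborel (\<lambda>s. s * W s)" "integrable lborel (\<lambda>s. s\<^sup>2 * W s)"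
    and line: "\<And>S. 0 \<le> (\<integral>a. W a * W (S - a) * var_kernel M a (S - a) \<partial>lborel)"
  defines "m0 \<equiv> (\<integral>s. W s \<partial>lborel)" and "m1 \<equiv> (\<integral>s. s * W s \<partial>lborel)"
    and "m2 \<equiv> (\<integral>s. s\<^sup>2 * W s \<partial>lborel)"
  shows "M * m2 * m0 \<le> M * m1 * m0 + (M - 1) * m1\<^sup>2"
proof -
  \<comment> \<open>In the coordinates \<open>(a, S)\<close>, having \<open>a\<close> and
    \<open>S - a\<close> in \<open>{0..M}\<close> forces \<open>S\<close> into
    \<open>{0..2 * M}\<close>.\<close>
  define A where "A = cbox (0, 0) (M, 2 * M)"
  have B: "0 \<le> B"
    using bnd[of 0] by linarith
  have meas: "(\<lambda>p. W (fst p) * W (snd p - fst p) * var_kernel M (fst p) (snd p - fst p))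
      \<in> borel_measurable (borel \<Otimes>\<^sub>M borel)"
    unfolding var_kernel_def by measurable
  have "integrable lborel (\<lambda>p. W (fst p) * W (snd p - fst p) * var_kernel M (fst p) (snd p - fst p))"
  proof (rule integrableI_bounded_set[where A = A and B = "B * B * (2 * M * (2 * M) + (2 * M + 1) * M\<^sup>2)"])
    show "A \<in> sets lborel" "emeasure lborel A < \<infinity>"
      using emeasure_lborel_cbox_finite[of "(0, 0)" "(M, 2 * M)"] by (simp_all add: A_def)
    show "(\<lambda>p. W (fst p) * W (snd p - fst p) * var_kernel M (fst p) (snd p - fst p)) \<in> borel_measurable lborel"
      using meas by (simp add: borel_prod)
    show "AE p in lborel. p \<in> A \<longrightarrow> norm (W (fst p) * W (snd p - fst p) * var_kernel M (fst p) (snd p - fst p))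
        \<le> B * B * (2 * M * (2 * M) + (2 * M + 1) * M\<^sup>2)"
    proof (intro AE_I2 impI)
      fix p assume "p \<in> A"
      define a b where "a = fst p" "b = snd p - fst p"
      show "norm (W (fst p) * W (snd p - fst p) * var_kernel M (fst p) (snd p - fst p))
        \<le> B * B * (2 * M * (2 * M) + (2 * M + 1) * M\<^sup>2)"
      proof (cases "a \<in> {0..M} \<and> b \<in> {0..M}")
        case True
        have "\<bar>(a + b) * (2 * M - (a + b))\<bar> \<le> 2 * M * (2 * M)"
          unfolding abs_mult using True by (intro mult_mono) auto
        moreover have "(a - b)\<^sup>2 \<le> M\<^sup>2"
          using True by (intro abs_le_square_iff[THEN iffD1]) auto
        \<comment> \<open>\<open>2 * M + 1\<close> dominates \<open>\<bar>2 * M - 1\<bar>\<close>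
          for either sign of \<open>2 * M - 1\<close>.\<close>
        then have "\<bar>(2 * M - 1) * (a - b)\<^sup>2\<bar> \<le> (2 * M + 1) * M\<^sup>2"
          unfolding abs_mult using M by (intro mult_mono) auto
        ultimately have "\<bar>var_kernel M a b\<bar> \<le> 2 * M * (2 * M) + (2 * M + 1) * M\<^sup>2"
          unfolding var_kernel_def by linarith
        then show ?thesis
          unfolding a_b_def(2)[symmetric] unfolding a_b_def(1)[symmetric] real_norm_def abs_mult
          using bnd B M by (intro mult_mono) auto
      next
        case False
        then have "W a * W b = 0"
          using supp by auto
        then show ?thesis
          unfolding a_b_def(2)[symmetric] unfolding a_b_def(1)[symmetric] using B M by auto
      qed
    qed
    show "AE p in lborel. p \<notin> A \<longrightarrow> W (fst p) * W (snd p - fst p) * var_kernel M (fst p) (snd p - fst p) = 0"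
    proof (intro AE_I2 impI)
      fix p assume "p \<notin> A"
      then have "fst p \<notin> {0..M} \<or> snd p - fst p \<notin> {0..M}"
        by (cases p) (auto simp: A_def cbox_Pair_eq)
      then show "W (fst p) * W (snd p - fst p) * var_kernel M (fst p) (snd p - fst p) = 0"
        using supp by auto
    qed
  qed
  then have "integrable (lborel \<Otimes>\<^sub>M lborel) (\<lambda>(a, S). W a * W (S - a) * var_kernel M a (S - a))"
    unfolding lborel_prod case_prod_beta .
  note fubini = lborel_pair.Fubini_integral[OF this]
  have "0 \<le> (\<integral>S. \<integral>a. W a * W (S - a) * var_kernel M a (S - a) \<partial>lborel \<partial>lborel)"
    by (rule Bochner_Integration.integral_nonneg) (rule line)
  also have "\<dots> = (\<integral>a. \<integral>S. W a * W (S - a) * var_kernel M a (S - a) \<partial>lborel \<partial>lborel)"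
    by (rule fubini)
  also have "\<dots> = (\<integral>a. \<integral>b. W a * W b * var_kernel M a b \<partial>lborel \<partial>lborel)"
  proof (rule Bochner_Integration.integral_cong[OF refl])
    fix a
    show "(\<integral>S. W a * W (S - a) * var_kernel M a (S - a) \<partial>lborel) = (\<integral>b. W a * W b * var_kernel M a b \<partial>lborel)"
      by (subst (2) lborel_integral_real_affine[where c = 1 and t = "-a"]) auto
  qed
  also have "\<dots> = (\<integral>a. (2 * M * m1 - 2 * M * m2) * W a
      + (2 * M * m0 + (4 * M - 4) * m1) * (a * W a) - (2 * M * m0) * (a\<^sup>2 * W a) \<partial>lborel)"
  proof (rule Bochner_Integration.integral_cong[OF refl])
    fix a
    have "(\<integral>b. W a * W b * var_kernel M a b \<partial>lborel)
      = (\<integral>b. (W a * (2 * M * a - 2 * M * a\<^sup>2)) * W b + (W a * (2 * M + (4 * M - 4) * a)) * (b * W b)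
           - (W a * (2 * M)) * (b\<^sup>2 * W b) \<partial>lborel)"
      by (intro Bochner_Integration.integral_cong refl)
        (simp add: var_kernel_def algebra_simps power2_eq_square)
    also have "\<dots> = (W a * (2 * M * a - 2 * M * a\<^sup>2)) * m0 + (W a * (2 * M + (4 * M - 4) * a)) * m1
           - (W a * (2 * M)) * m2"
      using int by (simp add: m0_def m1_def m2_def)
    finally show "(\<integral>b. W a * W b * var_kernel M a b \<partial>lborel) = (2 * M * m1 - 2 * M * m2) * W a
      + (2 * M * m0 + (4 * M - 4) * m1) * (a * W a) - (2 * M * m0) * (a\<^sup>2 * W a)"
      by (simp add: algebra_simps)
  qed
  also have "\<dots> = (2 * M * m1 - 2 * M * m2) * m0 + (2 * M * m0 + (4 * M - 4) * m1) * m1 - (2 * M * m0) * m2"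
    using int by (simp add: m0_def m1_def m2_def)
  also have "\<dots> = 4 * (M * m1 * m0 + (M - 1) * m1\<^sup>2 - M * m2 * m0)"
    by (simp add: algebra_simps power2_eq_square)
  finally show ?thesis
    by simp
qed

section \<open>Exponential moments\<close>

text \<open>The tangent inequality at \<open>y\<close> and at \<open>- y\<close> gives
  \<open>0 \<le> exp y - 1 - y \<le> y * (exp y - 1)\<close>. This remainder bound serves
  differentiation under the integral.\<close>

lemma exp_second_order_bound: "\<bar>exp y - 1 - y\<bar> \<le> y\<^sup>2 * exp \<bar>y\<bar>" for y :: real
proof -
  have 1: "exp y - 1 \<le> y * exp y"
    using mult_right_mono[OF exp_ge_add_one_self[of "-y"], of "exp y"]
    by (simp add: algebra_simps flip: exp_add)
  have 2: "1 + y \<le> exp y"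
    by (rule exp_ge_add_one_self)
  have "y * (exp y - 1) \<le> y\<^sup>2 * exp \<bar>y\<bar>"
  proof (cases "0 \<le> y")
    case True
    then show ?thesis
      using mult_left_mono[OF 1 True] by (simp add: power2_eq_square mult.assoc)
  next
    case False
    then have "(- y) * (1 - exp y) \<le> (- y) * (- y)"
      by (intro mult_left_mono) (use 2 in linarith)+
    also have "\<dots> \<le> y\<^sup>2 * exp \<bar>y\<bar>"
      using mult_left_mono[of 1 "exp \<bar>y\<bar>" "y\<^sup>2"] by (simp add: power2_eq_square)
    finally show ?thesis by (simp add: algebra_simps)
  qed
  then show ?thesis
    using 1 2 by (simp add: algebra_simps)
qed

lemma exp_moment_integrable:
  fixes W :: "real \<Rightarrow> real"
  assumes W[measurable]: "W \<in> borel_measurable borel"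
    and bnd: "\<And>s. \<bar>W s\<bar> \<le> B" and supp: "\<And>s. s \<notin> {0..M} \<Longrightarrow> W s = 0"
  shows "integrable lborel (\<lambda>s. s ^ k * (W s * exp (u * s)))"
proof (rule integrableI_bounded_set[where A = "{0..M}" and B = "M ^ k * (B * exp (\<bar>u\<bar> * M))"])
  show "AE s in lborel. s \<in> {0..M} \<longrightarrow> norm (s ^ k * (W s * exp (u * s))) \<le> M ^ k * (B * exp (\<bar>u\<bar> * M))"
  proof (intro AE_I2 impI)
    fix s assume s: "s \<in> {0..M}"
    have "u * s \<le> \<bar>u\<bar> * s"
      using s by (intro mult_right_mono) auto
    also have "\<dots> \<le> \<bar>u\<bar> * M"
      using s by (intro mult_left_mono) auto
    finally have "exp (u * s) \<le> exp (\<bar>u\<bar> * M)"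
      by simp
    moreover have "\<bar>s ^ k\<bar> \<le> M ^ k"
      using s by (auto intro: power_mono)
    moreover have "0 \<le> B"
      using bnd[of 0] by linarith
    ultimately show "norm (s ^ k * (W s * exp (u * s))) \<le> M ^ k * (B * exp (\<bar>u\<bar> * M))"
      unfolding real_norm_def abs_mult using s bnd[of s] by (intro mult_mono) auto
  qed
  show "AE s in lborel. s \<notin> {0..M} \<longrightarrow> s ^ k * (W s * exp (u * s)) = 0"
    using supp by (intro AE_I2) auto
qed (auto simp: emeasure_lborel_Icc_eq)

text \<open>The difference quotient minus the claimed derivative is the integral of
  \<open>g s\<close> times a Taylor remainder over \<open>t\<close>, which is \<open>O(t)\<close>
  uniformly on the support.\<close>

lemma exp_moment_has_derivative:
  fixes W :: "real \<Rightarrow> real"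
  assumes W: "W \<in> borel_measurable borel"
    and bnd: "\<And>s. \<bar>W s\<bar> \<le> B" and supp: "\<And>s. s \<notin> {0..M} \<Longrightarrow> W s = 0"
  shows "((\<lambda>u. \<integral>s. s ^ k * (W s * exp (u * s)) \<partial>lborel) has_real_derivative
           (\<integral>s. s ^ Suc k * (W s * exp (u * s)) \<partial>lborel)) (at u)"
proof -
  have int: "integrable lborel (\<lambda>s. s ^ j * (W s * exp (v * s)))" for j v
    by (rule exp_moment_integrable[OF W bnd supp])
  define g where "g s = s ^ k * (W s * exp (u * s))" for s
  \<comment> \<open>For \<open>\<bar>t\<bar> < 1\<close> and \<open>s\<close> in
    \<open>{0..M}\<close> the remainder of \<open>exp (t * s)\<close> is at most
    \<open>t\<^sup>2 * M\<^sup>2 * exp M\<close>.\<close>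
  define C where "C = (\<integral>s. \<bar>g s\<bar> * (M\<^sup>2 * exp M) \<partial>lborel)"
  define L where "L v = (\<integral>s. s ^ k * (W s * exp (v * s)) \<partial>lborel)" for v
  define D where "D = (\<integral>s. s ^ Suc k * (W s * exp (u * s)) \<partial>lborel)"
  have g_int: "integrable lborel g"
    unfolding g_def by (rule int)
  have bound: "norm ((L (u + t) - L u) / t - D) \<le> \<bar>t\<bar> * C" if t: "t \<noteq> 0" "\<bar>t\<bar> < 1" for t
  proof -
    have "(L (u + t) - L u) / t - D
       = (\<integral>s. (s ^ k * (W s * exp ((u + t) * s)) - s ^ k * (W s * exp (u * s))) / t
            - s ^ Suc k * (W s * exp (u * s)) \<partial>lborel)"
      unfolding L_def D_def using int[of k] int[of "Suc k"] by simp
    also have "\<dots> = (\<integral>s. g s * ((exp (t * s) - 1 - t * s) / t) \<partial>lborel)"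
      using t by (intro Bochner_Integration.integral_cong refl)
        (simp add: g_def field_simps exp_add)
    finally have eq: "(L (u + t) - L u) / t - D = (\<integral>s. g s * ((exp (t * s) - 1 - t * s) / t) \<partial>lborel)" .
    have pw: "norm (g s * ((exp (t * s) - 1 - t * s) / t)) \<le> \<bar>t\<bar> * (\<bar>g s\<bar> * (M\<^sup>2 * exp M))" for s
    proof (cases "s \<in> {0..M}")
      case True
      have "\<bar>exp (t * s) - 1 - t * s\<bar> \<le> (t * s)\<^sup>2 * exp \<bar>t * s\<bar>"
        by (rule exp_second_order_bound)
      also have "\<dots> \<le> (t\<^sup>2 * M\<^sup>2) * exp M"
      proof (intro mult_mono)
        show "(t * s)\<^sup>2 \<le> t\<^sup>2 * M\<^sup>2"
          using True by (auto simp: power_mult_distrib intro!: mult_left_mono power_mono)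
        have "\<bar>t\<bar> * \<bar>s\<bar> \<le> 1 * M"
          using t True by (intro mult_mono) auto
        then show "exp \<bar>t * s\<bar> \<le> exp M"
          by (simp add: abs_mult)
      qed auto
      finally have "\<bar>exp (t * s) - 1 - t * s\<bar> / \<bar>t\<bar> \<le> ((t\<^sup>2 * M\<^sup>2) * exp M) / \<bar>t\<bar>"
        by (intro divide_right_mono) auto
      also have "\<dots> = (t\<^sup>2 / \<bar>t\<bar>) * (M\<^sup>2 * exp M)"
        by simp
      also have "t\<^sup>2 / \<bar>t\<bar> = \<bar>t\<bar>"
        using t by (simp add: abs_if power2_eq_square)
      finally have "\<bar>g s\<bar> * (\<bar>exp (t * s) - 1 - t * s\<bar> / \<bar>t\<bar>) \<le> \<bar>g s\<bar> * (\<bar>t\<bar> * (M\<^sup>2 * exp M))"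
        by (intro mult_left_mono) auto
      then show ?thesis
        by (simp add: abs_mult mult_ac)
    qed (simp add: g_def supp)
    have "norm (\<integral>s. g s * ((exp (t * s) - 1 - t * s) / t) \<partial>lborel)
        \<le> (\<integral>s. \<bar>t\<bar> * (\<bar>g s\<bar> * (M\<^sup>2 * exp M)) \<partial>lborel)"
    proof (rule Bochner_Integration.integral_norm_bound_integral)
      show dom: "integrable lborel (\<lambda>s. \<bar>t\<bar> * (\<bar>g s\<bar> * (M\<^sup>2 * exp M)))"
        using g_int by simp
      have [measurable]: "g \<in> borel_measurable borel"
        using borel_measurable_integrable[OF g_int] by simp
      have "(\<lambda>s. g s * ((exp (t * s) - 1 - t * s) / t)) \<in> borel_measurable lborel"
        by measurable
      then show "integrable lborel (\<lambda>s. g s * ((exp (t * s) - 1 - t * s) / t))"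
        by (rule Bochner_Integration.integrable_bound[OF dom])
          (use pw in \<open>auto intro!: AE_I2 intro: order_trans[OF _ abs_ge_self]\<close>)
    qed (use pw in auto)
    also have "\<dots> = \<bar>t\<bar> * C"
      unfolding C_def by (rule Bochner_Integration.integral_mult_right_zero)
    finally show ?thesis
      unfolding eq .
  qed
  have "((\<lambda>t. (L (u + t) - L u) / t - D) \<longlongrightarrow> 0) (at 0)"
  proof (rule Lim_null_comparison)
    show "\<forall>\<^sub>F t in at 0. norm ((L (u + t) - L u) / t - D) \<le> \<bar>t\<bar> * C"
      unfolding eventually_at using bound by (intro exI[of _ 1]) (auto simp: dist_real_def)
    show "((\<lambda>t. \<bar>t\<bar> * C) \<longlongrightarrow> 0) (at 0)"
      by (auto intro!: tendsto_eq_intros)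
  qed
  then have "(\<lambda>t. (L (u + t) - L u) / t) \<midarrow>0\<rightarrow> D"
    by (simp add: Lim_null[symmetric])
  then show ?thesis
    unfolding DERIV_def L_def D_def .
qed

section \<open>Log-concavity of the transform\<close>

lemma log_concave_on_const_mult_exp:
  assumes g: "concave_on I g" and c: "0 \<le> c"
  shows "log_concave_on I (\<lambda>x. c * exp (g x))"
  unfolding log_concave_on_def
proof (intro conjI ballI allI impI)
  fix x y l :: real
  assume *: "x \<in> I" "y \<in> I" "0 < l \<and> l < 1"
  have "(c * exp (g x)) powr l * (c * exp (g y)) powr (1 - l)
     = (c powr l * c powr (1 - l)) * (exp (l * g x) * exp ((1 - l) * g y))"
    using c by (simp add: powr_mult exp_powr_real mult_ac)
  also have "c powr l * c powr (1 - l) = c"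
    using c by (simp flip: powr_add)
  also have "exp (l * g x) * exp ((1 - l) * g y) = exp (l * g x + (1 - l) * g y)"
    by (rule exp_add[symmetric])
  also have "c * \<dots> \<le> c * exp (g (l * x + (1 - l) * y))"
    using c * concave_onD[OF g, of "1 - l" x y] by (intro mult_left_mono) auto
  finally show "c * exp (g (l * x + (1 - l) * y))
      \<ge> (c * exp (g x)) powr l * (c * exp (g y)) powr (1 - l)" .
qed (use c in simp)

text \<open>\<open>L0\<close>, \<open>L1\<close>, \<open>L2\<close> stand for the moments of order
  0, 1, 2 of the tilted density, and \<open>var\<close> is the variance bound cleared of
  denominators.\<close>

lemma concave_on_log_transform:
  fixes L0 L1 L2 :: "real \<Rightarrow> real"
  assumes M: "0 < M" and pos: "\<And>u. 0 < L0 u"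
    and d0: "\<And>u. (L0 has_real_derivative L1 u) (at u)"
    and d1: "\<And>u. (L1 has_real_derivative L2 u) (at u)"
    and var: "\<And>u. M * L2 u * L0 u \<le> M * L1 u * L0 u + (M - 1) * (L1 u)\<^sup>2"
  shows "concave_on {0<..<1} (\<lambda>x. M * ln x + ln (L0 (ln (1 - x) - ln x)))"
proof (rule f''_le0_imp_concave)
  define U where "U x = ln (1 - x) - ln x" for x :: real
  define U' where "U' x = - 1 / (1 - x) - 1 / x" for x :: real
  define U'' where "U'' x = - 1 / (1 - x)\<^sup>2 + 1 / x\<^sup>2" for x :: real
  define m where "m u = L1 u / L0 u" for u
  define v where "v u = L2 u / L0 u - (m u)\<^sup>2" for u
  have dU: "(U has_real_derivative U' x) (at x)" if "x \<in> {0<..<1}" for x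
    unfolding U_def U'_def using that by (auto intro!: derivative_eq_intros)
  have dU': "(U' has_real_derivative U'' x) (at x)" if "x \<in> {0<..<1}" for x
    unfolding U'_def U''_def using that by (auto intro!: derivative_eq_intros simp: power2_eq_square)
  have dm: "(m has_real_derivative v u) (at u)" for u
  proof -
    have "(m has_real_derivative (L2 u * L0 u - L1 u * L1 u) / (L0 u * L0 u)) (at u)"
      unfolding m_def using pos[of u] by (intro DERIV_divide d0 d1) auto
    also have "(L2 u * L0 u - L1 u * L1 u) / (L0 u * L0 u) = v u"
      using pos[of u] by (simp add: v_def m_def field_simps power2_eq_square)
    finally show ?thesis .
  qed
  show "convex {0<..<1::real}"
    by simp
  fix x :: real assume x: "x \<in> {0<..<1}"
  show "((\<lambda>x. M * ln x + ln (L0 (ln (1 - x) - ln x))) has_real_derivative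
      (M / x + m (U x) * U' x)) (at x)"
  proof -
    have "((\<lambda>x. ln (L0 (U x))) has_real_derivative (1 / L0 (U x)) * (L1 (U x) * U' x)) (at x)"
      by (intro DERIV_chain2[OF DERIV_ln_divide] DERIV_chain2[OF d0] dU x pos)
    moreover have "((\<lambda>x. M * ln x) has_real_derivative M * (1 / x)) (at x)"
      using x by (intro DERIV_cmult DERIV_ln_divide) auto
    ultimately show ?thesis
      unfolding U_def[symmetric] m_def using DERIV_add by fastforce
  qed
  show "((\<lambda>x. M / x + m (U x) * U' x) has_real_derivative
      (- M / x\<^sup>2 + (v (U x) * U' x * U' x + U'' x * m (U x)))) (at x)"
  proof (rule DERIV_add)
    show "((\<lambda>x. M / x) has_real_derivative - M / x\<^sup>2) (at x)"
      using x by (auto intro!: derivative_eq_intros simp: power2_eq_square)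
    show "((\<lambda>x. m (U x) * U' x) has_real_derivative v (U x) * U' x * U' x + U'' x * m (U x)) (at x)"
      by (intro DERIV_mult DERIV_chain2[OF dm] dU dU' x)
  qed
  show "- M / x\<^sup>2 + (v (U x) * U' x * U' x + U'' x * m (U x)) \<le> 0"
  proof -
    define u p where "u = U x" "p = 1 - x"
    have xp: "0 < x" "0 < p" "x = 1 - p"
      using x by (auto simp: u_p_def)
    have "L2 u / L0 u \<le> m u + (1 - 1 / M) * (m u)\<^sup>2"
      using var[of u] M pos[of u] by (simp add: m_def field_simps power2_eq_square)
    then have v: "v u \<le> m u - (m u)\<^sup>2 / M"
      by (simp add: v_def algebra_simps)
    have "U' x = - (x + p) / (p * x)"
      using xp(1,2) unfolding U'_def u_p_def(2)[symmetric] by (simp add: divide_simps)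
    then have "U' x = - 1 / (p * x)"
      using xp(3) by simp
    then have sq: "U' x * U' x = 1 / (p * x)\<^sup>2"
      by (simp add: power2_eq_square)
    have U'': "U'' x = (p\<^sup>2 - x\<^sup>2) / (p * x)\<^sup>2"
      using xp(1,2) unfolding U''_def u_p_def(2)[symmetric] by (simp add: field_simps)
    have M': "- M / x\<^sup>2 = (- M * p\<^sup>2) / (p * x)\<^sup>2"
      using xp(1,2) by (simp add: field_simps)
    \<comment> \<open>The variance \<open>v u\<close> enters with the square of \<open>U' x\<close>
      as factor, so its upper bound may be inserted.\<close>
    have "- M / x\<^sup>2 + (v u * U' x * U' x + U'' x * m u)
       \<le> - M / x\<^sup>2 + ((m u - (m u)\<^sup>2 / M) * (U' x * U' x) + U'' x * m u)"
      unfolding mult.assoc[of "v u"] using v by (intro add_left_mono add_right_mono mult_right_mono) auto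
    also have "\<dots> = (- M * p\<^sup>2 + (m u - (m u)\<^sup>2 / M) + (p\<^sup>2 - x\<^sup>2) * m u) / (p * x)\<^sup>2"
      unfolding sq U'' M' by (simp add: add_divide_distrib diff_divide_distrib left_diff_distrib)
    \<comment> \<open>Since \<open>x + p = 1\<close>, the linear coefficient is
      \<open>1 + p\<^sup>2 - x\<^sup>2 = 2 * p\<close>, which completes the square.\<close>
    also have "- M * p\<^sup>2 + (m u - (m u)\<^sup>2 / M) + (p\<^sup>2 - x\<^sup>2) * m u = - ((M * p - m u)\<^sup>2 / M)"
      unfolding xp(3) using M by (simp add: field_simps power2_eq_square)
    also have "\<dots> / (p * x)\<^sup>2 \<le> 0"
      using M by simp
    finally show ?thesis
      by (simp add: u_p_def)
  qed
qed

theorem theorem1: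
  fixes M :: real and \<alpha> :: "real \<Rightarrow> real"
  assumes "M > 1"
    and "log_concave_on {0<..<M} \<alpha>"
  shows "log_concave_on {0<..<1}
           (\<lambda>x. integral {0..M}
                  (\<lambda>s. \<alpha> s * gbinom M s * (1 - x) powr s * x powr (M - s)))"
proof -
  note M = assms(1) and \<alpha> = assms(2)
  define W where "W = truncated_density M \<alpha>"
  define L where "L k u = (\<integral>s. s ^ k * (W s * exp (u * s)) \<partial>lborel)" for k :: nat and u
  define F where "F x = integral {0..M} (\<lambda>s. \<alpha> s * gbinom M s * (1 - x) powr s * x powr (M - s))" for x
  have W_nonneg: "0 \<le> W s" for s
    unfolding W_def by (rule truncated_density_nonneg[OF \<alpha>])
  have W_alt: "W = (\<lambda>s. (indicator {0<..<M} s * \<alpha> s) * binom_weight M s)"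
    by (simp add: W_def truncated_density_def fun_eq_iff)
  have [measurable]: "(\<lambda>s. indicator {0<..<M} s * \<alpha> s) \<in> borel_measurable borel"
    by (rule log_concave_on_borel_measurable[OF \<alpha>]) (simp add: is_interval_oo)
  have [measurable]: "binom_weight M \<in> borel_measurable borel"
    using continuous_on_binom_weight[of UNIV "\<lambda>x. x" M]
    by (intro borel_measurable_continuous_onI) simp
  have W_meas: "W \<in> borel_measurable borel"
    unfolding W_alt by measurable
  have W_supp: "W s = 0" if "s \<notin> {0..M}" for s
    using that by (auto simp: W_alt indicator_def)
  obtain B where B: "\<bar>W s\<bar> \<le> B" for s
  proof -
    obtain B1 where B1: "\<And>s. s \<in> {0<..<M} \<Longrightarrow> \<alpha> s \<le> B1"
      using log_concave_on_bounded[OF \<alpha>] by blast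
    have "compact (binom_weight M ` {0..M})"
      using continuous_on_binom_weight[of "{0..M}" "\<lambda>x. x" M]
      by (intro compact_continuous_image) auto
    then have "bounded (binom_weight M ` {0..M})"
      by (rule compact_imp_bounded)
    then obtain B2 where "\<forall>y\<in>binom_weight M ` {0..M}. norm y \<le> B2"
      unfolding bounded_iff by blast
    then have B2: "\<bar>binom_weight M s\<bar> \<le> B2" if "s \<in> {0..M}" for s
      using that by simp
    have B12: "0 \<le> B1" "0 \<le> B2"
      using B1[of "M / 2"] log_concave_on_nonneg[OF \<alpha>, of "M / 2"] B2[of 0] M by auto
    have "\<bar>W s\<bar> \<le> B1 * B2" for s
    proof (cases "s \<in> {0<..<M}")
      case True
      then have "\<bar>\<alpha> s\<bar> * \<bar>binom_weight M s\<bar> \<le> B1 * B2"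
        using B1[of s] B2[of s] B12 log_concave_on_nonneg[OF \<alpha> True] by (intro mult_mono) auto
      then show ?thesis
        using True by (simp add: W_alt abs_mult)
    qed (use B12 in \<open>simp add: W_alt\<close>)
    then show ?thesis by (rule that)
  qed
  have int: "integrable lborel (\<lambda>s. s ^ k * (W s * exp (u * s)))" for k u
    by (rule exp_moment_integrable[OF W_meas B W_supp])
  have L_deriv: "(L k has_real_derivative L (Suc k) u) (at u)" for k u
    unfolding L_def by (rule exp_moment_has_derivative[OF W_meas B W_supp])
  have var: "M * L 2 u * L 0 u \<le> M * L 1 u * L 0 u + (M - 1) * (L 1 u)\<^sup>2" for u
  proof -
    \<comment> \<open>Tilting commutes with truncation, so \<open>V\<close> is the truncated density
      of the log-concave \<open>h\<close>, and its moments are the \<open>L k u\<close>.\<close>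
    define h where "h s = \<alpha> s * exp (u * s)" for s
    define V where "V s = W s * exp (u * s)" for s
    have h: "log_concave_on {0<..<M} h"
      unfolding h_def by (rule log_concave_on_exp_mult[OF \<alpha>])
    have V: "V = truncated_density M h"
      by (simp add: V_def h_def W_def truncated_density_def fun_eq_iff)
    have V_int: "integrable lborel (\<lambda>s. s ^ k * V s)" for k
      unfolding V_def by (rule int)
    have "M * (\<integral>s. s\<^sup>2 * V s \<partial>lborel) * (\<integral>s. V s \<partial>lborel)
      \<le> M * (\<integral>s. s * V s \<partial>lborel) * (\<integral>s. V s \<partial>lborel) + (M - 1) * (\<integral>s. s * V s \<partial>lborel)\<^sup>2"
    proof (rule variance_bound_of_line_integrals)
      show "V \<in> borel_measurable borel"
        unfolding V_def using W_meas by measurable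
      show "V s = 0" if "s \<notin> {0..M}" for s
        using W_supp[OF that] by (simp add: V_def)
      show "\<bar>V s\<bar> \<le> B * exp (\<bar>u\<bar> * M)" for s
      proof (cases "s \<in> {0..M}")
        case True
        have "u * s \<le> \<bar>u\<bar> * s"
          using True by (intro mult_right_mono) auto
        also have "\<dots> \<le> \<bar>u\<bar> * M"
          using True by (intro mult_left_mono) auto
        finally show ?thesis
          unfolding V_def abs_mult using B[of s] by (intro mult_mono) auto
      next
        case False
        then show ?thesis
          using W_supp[OF False] B[of s] by (simp add: V_def)
      qed
      show "integrable lborel V" "integrable lborel (\<lambda>s. s * V s)" "integrable lborel (\<lambda>s. s\<^sup>2 * V s)"
        using V_int[of 0] V_int[of 1] V_int[of 2] by simp_all
      show "0 \<le> (\<integral>a. V a * V (S - a) * var_kernel M a (S - a) \<partial>lborel)" for S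
        unfolding V by (rule line_integral_nonneg[OF M h])
    qed (use M in simp)
    then show ?thesis
      by (simp add: L_def V_def)
  qed
  have F_eq: "F x = Gamma (M + 1) * (x powr M * L 0 (ln (1 - x) - ln x))" if x: "x \<in> {0<..<1}" for x
  proof -
    define u where "u = ln (1 - x) - ln x"
    define f where "f s = \<alpha> s * gbinom M s * (1 - x) powr s * x powr (M - s)" for s
    have eq: "indicator {0<..<M} s *\<^sub>R f s = (Gamma (M + 1) * x powr M) * (s ^ 0 * (W s * exp (u * s)))" for s
    proof -
      have "(1 - x) powr s * x powr (M - s) = x powr M * exp (u * s)"
        using x by (simp add: powr_def u_def algebra_simps flip: exp_add)
      then have "f s = \<alpha> s * gbinom M s * (x powr M * exp (u * s))"
        by (simp add: f_def mult.assoc)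
      then show ?thesis
        by (simp add: W_alt gbinom_eq_binom_weight)
    qed
    have f_int: "set_integrable lborel {0<..<M} f"
      unfolding set_integrable_def eq by (intro integrable_mult_right int)
    \<comment> \<open>The endpoints 0 and \<open>M\<close>, where \<alpha> is unconstrained, form a
      null set.\<close>
    have "F x = (LINT s:{0<..<M}|lborel. f s)"
      unfolding F_def f_def[symmetric] integral_open_interval_real
      using set_borel_integral_eq_integral(2)[OF f_int] by simp
    also have "\<dots> = (Gamma (M + 1) * x powr M) * L 0 u"
      unfolding set_lebesgue_integral_def eq L_def by (rule Bochner_Integration.integral_mult_right_zero)
    finally show ?thesis
      by (simp add: u_def)
  qed
  have L_nonneg: "0 \<le> L 0 u" for u
    unfolding L_def using W_nonneg by (intro Bochner_Integration.integral_nonneg) auto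
  \<comment> \<open>If \<open>L 0\<close> vanishes at one point, then \<open>W = 0\<close> almost
    everywhere and \<open>F\<close> is zero on the interval; otherwise \<open>ln (L 0 u)\<close> is
    meaningful for every \<open>u\<close>.\<close>
  have "log_concave_on {0<..<1} F"
  proof (cases "\<exists>u. L 0 u = 0")
    case True
    then obtain u0 where "L 0 u0 = 0" by blast
    then have "AE s in lborel. W s = 0"
      using integral_nonneg_eq_0_iff_AE[OF int[of 0 u0]] W_nonneg by (simp add: L_def)
    then have "L 0 u = 0" for u
      unfolding L_def by (intro integral_eq_zero_AE) auto
    then have F0: "F x = 0" if "x \<in> {0<..<1}" for x
      using F_eq[OF that] by simp
    have "l * x + (1 - l) * y \<in> {0<..<1}" if "x \<in> {0<..<1}" "y \<in> {0<..<1}" "0 < l" "l < 1" for x y l :: real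
      using convexD[of "{0<..<1::real}" x y l "1 - l"] that by simp
    then show ?thesis
      using F0 unfolding log_concave_on_def by simp
  next
    case False
    then have pos: "0 < L 0 u" for u
      using L_nonneg[of u] by (metis less_eq_real_def)
    define g where "g x = M * ln x + ln (L 0 (ln (1 - x) - ln x))" for x
    have "concave_on {0<..<1} g"
      unfolding g_def
      using M pos L_deriv[of 0] L_deriv[of 1] var
      by (intro concave_on_log_transform[where ?L1.0 = "L 1" and ?L2.0 = "L 2"]) (auto simp: numeral_2_eq_2)
    then have "log_concave_on {0<..<1} (\<lambda>x. Gamma (M + 1) * exp (g x))"
      using M by (intro log_concave_on_const_mult_exp) (auto intro: less_imp_le Gamma_real_pos)
    moreover have "F x = Gamma (M + 1) * exp (g x)" if "x \<in> {0<..<1}" for x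
      using F_eq[OF that] that pos by (simp add: g_def exp_add powr_def)
    moreover have "l * x + (1 - l) * y \<in> {0<..<1}" if "x \<in> {0<..<1}" "y \<in> {0<..<1}" "0 < l" "l < 1" for x y l :: real
      using convexD[of "{0<..<1::real}" x y l "1 - l"] that by simp
    ultimately show ?thesis
      unfolding log_concave_on_def by simp
  qed
  then show ?thesis
    unfolding F_def .
qed

end
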